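(* Let $p_-<0<p_+$ and $\lambda_-,\lambda_+>0$. Let $(X,E)$ be the piecewise deterministic process on $\mathbb{R}\times I$, $I=\{-1,1\}$, obtained by switching between $f_{-1}(x)=p_--x^2$ and $f_1(x)=p_+-x^2$, with constant rate $\lambda_-$ of switching from $f_{-1}$ to $f_1$ and constant rate $\lambda_+$ of switching from $f_1$ to $f_{-1}$. Let $\nu$ be a probability measure on $\mathbb{R}\times I$. For $a<-\sqrt{p_+}$ let $\tau_a=\inf\{t\ge0:X_t\le a\}$, and let $\nu\mathsf{P}^{\tau_a}$ be the law of $(X,E)$ with initial distribution $\nu$ and stopped at time $\tau_a$. Then there is a nondecreasing function $g:(-\infty,-\sqrt{p_+}-2]\to(0,\infty)$ with $\int_{-\infty}^{-\sqrt{p_+}-2}g(a)\,da<\infty$ such that for every $a\le-\sqrt{p_+}-2$, $$\nu\mathsf{P}^{\tau_a}\left(\tau_{-\sqrt{p_+}-1}<\infty\right)=1\qquad\text{and}\qquad\nu\mathsf{P}^{\tau_a}\left(\tau_a-\tau_{a+1}<g(a)\;\middle|\;\tau_{-\sqrt{p_+}-1}<\infty\right)=1.$$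
   Context: The process $(X,E)$: $E=(E_t)_{t\ge0}$ is the continuous-time Markov chain on $I=\{-1,1\}$ that jumps from $-1$ to $1$ at rate $\lambda_-$ and from $1$ to $-1$ at rate $\lambda_+$ (rates independent of $X$), and $X$ solves $X_t=X_0+\int_0^t f_{E_s}(X_s)\,ds$. The vector fields are not forward complete (trajectories may go to $-\infty$ in finite time), but $(X,E)$ stopped at $\tau_a$, i.e. $(X_{t\wedge\tau_a},E_{t\wedge\tau_a})_{t\ge0}$, is well defined for all times. Convention: $\inf\emptyset=\infty$. *)

theory Defs
  imports "HOL-Probability.Probability"
begin

definition state_space :: "(real \<times> int) measure" where
  "state_space = borel \<Otimes>\<^sub>M count_space {-1, 1}"

definition vec_field :: "real \<Rightarrow> real \<Rightarrow> int \<Rightarrow> real \<Rightarrow> real" where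
  "vec_field p_minus p_plus i x = (if i = 1 then p_plus else p_minus) - x\<^sup>2"

text \<open>The rate at which the state \<open>i\<close> is left.\<close>

definition exit_rate :: "real \<Rightarrow> real \<Rightarrow> int \<Rightarrow> real" where
  "exit_rate lam_minus lam_plus i = (if i = 1 then lam_plus else lam_minus)"

text \<open>
  Continuous-time Markov chain on \<open>{-1, 1}\<close> in its jump chain / holding time description.
  \<open>H n\<close> is the time between the \<open>n\<close>-th and the \<open>(n+1)\<close>-st jump; during that time the
  state is \<open>(-1) ^ n * E 0\<close>, since every jump changes the sign. The product law says that
  \<open>(X0, E 0)\<close> has law \<open>\<nu>\<close> and that the holding times, multiplied by the rate of the current
  state, are i.i.d. standard exponential and independent of \<open>(X0, E 0)\<close>; equivalently, given
  \<open>(X0, E 0)\<close>, the holding times are independent and exponential with the rates of the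
  successive states. Positivity of the holding times and non-explosion hold almost surely in
  any case; as is usual for right-continuous versions with left limits, they are required
  for every sample point.
\<close>

definition switching_chain ::
  "real \<Rightarrow> real \<Rightarrow> (real \<times> int) measure \<Rightarrow> 'w measure \<Rightarrow>
   ('w \<Rightarrow> real) \<Rightarrow> (real \<Rightarrow> 'w \<Rightarrow> int) \<Rightarrow> bool" where
  "switching_chain lam_minus lam_plus \<nu> M X0 E \<longleftrightarrow>
     (\<exists>H :: nat \<Rightarrow> 'w \<Rightarrow> real.
        (\<forall>\<omega>\<in>space M.
           (\<forall>n. 0 < H n \<omega>) \<and>
           filterlim (\<lambda>n. \<Sum>k<n. H k \<omega>) at_top sequentially \<and>
           (\<forall>n t. (\<Sum>k<n. H k \<omega>) \<le> t \<and> t < (\<Sum>k<Suc n. H k \<omega>) \<longrightarrow>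
              E t \<omega> = (-1) ^ n * E 0 \<omega>)) \<and>
        (let \<mu> = \<nu> \<Otimes>\<^sub>M PiM UNIV (\<lambda>_ :: nat. density lborel (exponential_density 1));
             \<Psi> = (\<lambda>\<omega>. ((X0 \<omega>, E 0 \<omega>),
                   \<lambda>n. exit_rate lam_minus lam_plus ((-1) ^ n * E 0 \<omega>) * H n \<omega>))
         in \<Psi> \<in> measurable M \<mu> \<and> distr M \<mu> \<Psi> = \<mu>))"

definition hitting_time :: "real \<Rightarrow> (real \<Rightarrow> real) \<Rightarrow> ereal" where
  "hitting_time a x = Inf {ereal t | t. 0 \<le> t \<and> x t \<le> a}"

definition stop_at :: "ereal \<Rightarrow> real \<Rightarrow> real" where
  "stop_at \<tau> t = real_of_ereal (min (ereal t) \<tau>)"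

text \<open>
  \<open>(X, F)\<close> is a realization on the probability space \<open>M\<close> of the switched process with
  initial distribution \<open>\<nu>\<close>, stopped at the hitting time \<open>\<tau>\<close> of \<open>(-\<infinity>, a]\<close>:
    \<open>X\<^sub>t = X\<^sub>0 + \<integral>\<^bsub>0\<^esub>\<^bsup>min t \<tau>\<^esup> vec_field (E\<^sub>s) (X\<^sub>s) ds\<close> and \<open>F\<^sub>t = E (min t \<tau>)\<close>.
  The unstopped \<open>X\<close> may explode, so the stopped process is described directly. As \<open>X\<close> agrees
  with the unstopped process up to \<open>\<tau>\<close> and is constant afterwards, the hitting times of all
  levels \<open>b \<ge> a\<close> may be computed from it. The driving chain \<open>E\<close> lives for all times.
\<close>

definition stopped_pdmp ::
  "real \<Rightarrow> real \<Rightarrow> real \<Rightarrow> real \<Rightarrow> (real \<times> int) measure \<Rightarrow> real \<Rightarrow>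
   'w measure \<Rightarrow> (real \<Rightarrow> 'w \<Rightarrow> real) \<Rightarrow> (real \<Rightarrow> 'w \<Rightarrow> int) \<Rightarrow> bool" where
  "stopped_pdmp p_minus p_plus lam_minus lam_plus \<nu> a M X F \<longleftrightarrow>
     prob_space M \<and>
     (\<forall>t\<ge>0. X t \<in> borel_measurable M) \<and>
     (\<exists>E. switching_chain lam_minus lam_plus \<nu> M (X 0) E \<and>
          (\<forall>\<omega>\<in>space M. \<forall>t\<ge>0.
             let s = stop_at (hitting_time a (\<lambda>u. X u \<omega>)) t in
             ((\<lambda>u. vec_field p_minus p_plus (E u \<omega>) (X u \<omega>)) has_integral (X t \<omega> - X 0 \<omega>)) {0..s} \<and>
             F t \<omega> = E s \<omega>))"

end

theory Submission
  imports Defs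
begin

text \<open>
  Left of \<open>- sqrt p_plus\<close> both vector fields point to the left, so every level there is a barrier
  and the passage from \<open>a + 1\<close> to \<open>a\<close> takes at most \<open>1 / ((a + 1)\<^sup>2 - p_plus)\<close>, whatever the
  chain does; this bound is of order \<open>1 / a\<^sup>2\<close> and hence integrable. That region is reached almost
  surely because the chain almost surely has a long holding time in the state \<open>-1\<close>, and the flow of
  \<open>p_minus - x\<^sup>2\<close> explodes to \<open>-\<infinity>\<close> within a time that does not depend on its starting point.
\<close>

section \<open>Hitting times of real paths\<close>

lemma hitting_time_finite_iff: "hitting_time a x < \<infinity> \<longleftrightarrow> (\<exists>t\<ge>0. x t \<le> a)"
proof
  assume "hitting_time a x < \<infinity>"
  then show "\<exists>t\<ge>0. x t \<le> a"
    unfolding hitting_time_def Inf_less_iff by auto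
next
  assume "\<exists>t\<ge>0. x t \<le> a"
  then show "hitting_time a x < \<infinity>"
    unfolding hitting_time_def Inf_less_iff by auto
qed

text \<open>By continuity the set of times at or below the level is closed, so its infimum is a
  minimum; the extended real infimum becomes an honest first passage time.\<close>

lemma hitting_time_attained:
  assumes cont: "continuous_on {0..} x" and hit: "\<exists>t\<ge>0. x t \<le> a"
  obtains T where "0 \<le> T" "hitting_time a x = ereal T" "x T \<le> a" "\<And>t. 0 \<le> t \<Longrightarrow> t < T \<Longrightarrow> a < x t"
proof
  let ?S = "{t \<in> {0..}. x t \<le> a}"
  define T where "T = Inf ?S"
  have ne: "?S \<noteq> {}" using hit by auto
  have bdd: "bdd_below ?S" by (auto intro: bdd_belowI[of _ 0])
  have "closed ?S"
    by (intro continuous_on_closed_Collect_le cont continuous_intros closed_atLeast)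
  then have "T \<in> ?S"
    unfolding T_def using ne bdd by (intro closed_contains_Inf)
  then show "0 \<le> T" and T: "x T \<le> a" by auto
  show "a < x t" if "0 \<le> t" "t < T" for t
    using cInf_lower[OF _ bdd, of t] that by (force simp: T_def)
  then have "\<And>t. 0 \<le> t \<Longrightarrow> x t \<le> a \<Longrightarrow> T \<le> t" by (meson leI not_le)
  then show "hitting_time a x = ereal T"
    unfolding hitting_time_def using T \<open>0 \<le> T\<close>
    by (intro antisym Inf_lower Inf_greatest) auto
qed

section \<open>Single sample paths of the stopped equation, and measurability of hitting
  events\<close>

text \<open>The setting is one fixed sample point. Since \<open>e\<close> is an arbitrary function,
  the pathwise estimates hold uniformly over all switching sequences.\<close>

locale stopped_path =
  fixes p_minus p_plus a :: real and e :: "real \<Rightarrow> int" and x :: "real \<Rightarrow> real"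
  assumes p_less: "p_minus < 0" "0 < p_plus"
    and integral: "\<And>t. 0 \<le> t \<Longrightarrow>
      ((\<lambda>u. vec_field p_minus p_plus (e u) (x u)) has_integral (x t - x 0))
        {0..stop_at (hitting_time a x) t}"
begin

abbreviation f :: "real \<Rightarrow> real" where
  "f u \<equiv> vec_field p_minus p_plus (e u) (x u)"

lemma f_le: "f u \<le> p_plus - (x u)\<^sup>2"
  using p_less by (auto simp: vec_field_def)

lemma hitting_time_nonneg: "0 \<le> hitting_time a x"
  by (auto simp: hitting_time_def intro!: Inf_greatest)

text \<open>For all times up to \<open>T\<close> the integrals then run inside one fixed interval,
  where continuity of a single indefinite integral can be used.\<close>

lemma stop_at_min:
  assumes "0 \<le> t" "t \<le> T"
  shows "stop_at (hitting_time a x) t = min t (stop_at (hitting_time a x) T)"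
  using assms hitting_time_nonneg
  by (cases "hitting_time a x") (auto simp: stop_at_def min_def)

lemma stop_at_eq:
  assumes "0 \<le> t" "\<And>u. 0 \<le> u \<Longrightarrow> u < t \<Longrightarrow> a < x u"
  shows "stop_at (hitting_time a x) t = t"
proof -
  have "ereal t \<le> hitting_time a x"
    unfolding hitting_time_def using assms(2) by (force intro!: Inf_greatest)
  then show ?thesis by (simp add: stop_at_def min_def)
qed

lemma continuous: "continuous_on {0..} x"
proof -
  \<comment> \<open>Reflecting time makes \<open>0\<close> an interior point of a symmetric
    interval, so the endpoint needs no one-sided argument.\<close>
  have "isCont (\<lambda>t. x \<bar>t\<bar>) t" for t
  proof -
    define T where "T = \<bar>t\<bar> + 1"
    define T' where "T' = stop_at (hitting_time a x) T"
    have T: "0 \<le> T" by (simp add: T_def)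
    have T': "0 \<le> T'"
      using hitting_time_nonneg T by (cases "hitting_time a x") (auto simp: T'_def stop_at_def min_def)
    have "f integrable_on {0..T'}"
      using integral[OF T] by (auto simp: T'_def)
    from indefinite_integral_continuous_1[OF this]
    have c: "continuous_on {0..T'} (\<lambda>t. Henstock_Kurzweil_Integration.integral {0..t} f)" .
    have *: "x 0 + Henstock_Kurzweil_Integration.integral {0..min \<bar>s\<bar> T'} f = x \<bar>s\<bar>" if "s \<in> {-T..T}" for s
      using integral_unique[OF integral[of "\<bar>s\<bar>"]] that stop_at_min[of "\<bar>s\<bar>" T] by (auto simp: T'_def)
    have "continuous_on {-T..T} (\<lambda>s. x 0 + Henstock_Kurzweil_Integration.integral {0..min \<bar>s\<bar> T'} f)"
      by (intro continuous_intros continuous_on_compose2[OF c]) (auto simp: T')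
    then have "continuous_on {-T..T} (\<lambda>s. x \<bar>s\<bar>)"
      by (rule continuous_on_eq) (rule *)
    then show ?thesis
      by (rule continuous_on_interior) (auto simp: T_def)
  qed
  then have "continuous_on {0..} (\<lambda>t. x \<bar>t\<bar>)"
    by (simp add: continuous_at_imp_continuous_on)
  then show ?thesis by (rule continuous_on_eq) auto
qed

lemma increment:
  assumes "0 \<le> u" "u \<le> v" and run: "\<And>s. 0 \<le> s \<Longrightarrow> s < v \<Longrightarrow> a < x s"
  shows "(f has_integral (x v - x u)) {u..v}"
proof -
  have v: "(f has_integral (x v - x 0)) {0..v}"
    using integral[of v] stop_at_eq[of v] assms by auto
  have u: "(f has_integral (x u - x 0)) {0..u}"
    using integral[of u] stop_at_eq[of u] assms by auto
  have "f integrable_on {u..v}"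
    using assms(1,2)
    by (intro integrable_subinterval_real[OF has_integral_integrable[OF v]]) auto
  then obtain j where j: "(f has_integral j) {u..v}" by blast
  have "x u - x 0 + j = x v - x 0"
    using has_integral_combine[OF assms(1,2) u j] v by (rule has_integral_unique)
  then have "j = x v - x u" by simp
  with j show ?thesis by simp
qed

text \<open>Both fields lie below \<open>p_plus - x^2\<close>, which is increasing on the negative
  half-line. With \<open>c = - sqrt p_plus\<close> this says that the path cannot rise; with smaller
  \<open>c\<close> it gives a linear descent.\<close>

lemma increment_le:
  assumes "0 \<le> u" "u \<le> v" and run: "\<And>s. 0 \<le> s \<Longrightarrow> s < v \<Longrightarrow> a < x s"
    and c: "\<And>s. u \<le> s \<Longrightarrow> s \<le> v \<Longrightarrow> x s \<le> c" "c \<le> 0"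
  shows "x v - x u \<le> (v - u) * (p_plus - c\<^sup>2)"
proof -
  have const: "((\<lambda>_. p_plus - c\<^sup>2) has_integral (v - u) * (p_plus - c\<^sup>2)) {u..v}"
    using has_integral_const_real[of "p_plus - c\<^sup>2" u v] assms(2) by simp
  show ?thesis
  proof (rule has_integral_le[OF increment[OF assms(1-3)] const])
    fix s assume "s \<in> {u..v}"
    then have "x s \<le> c" using c(1)[of s] by simp
    then have "c\<^sup>2 \<le> (x s)\<^sup>2" using c(2) by (simp add: abs_le_square_iff[symmetric])
    then show "f s \<le> p_plus - c\<^sup>2" using f_le[of s] by simp
  qed
qed

text \<open>Consider the last time \<open>r\<close> at or below \<open>c\<close>. Just afterwards
  the path would be above \<open>c\<close> but still below \<open>- sqrt p_plus\<close>, a region in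
  which it cannot rise.\<close>

lemma barrier:
  assumes c: "c < - sqrt p_plus" and "0 \<le> t0" "x t0 \<le> c" "t0 \<le> t"
    and run: "\<And>s. 0 \<le> s \<Longrightarrow> s < t \<Longrightarrow> a < x s"
  shows "x t \<le> c"
proof (rule ccontr)
  assume nle: "\<not> x t \<le> c"
  let ?S = "{s \<in> {t0..t}. x s \<le> c}"
  define r where "r = Sup ?S"
  have cont: "continuous_on {t0..t} x"
    using assms by (intro continuous_on_subset[OF continuous]) auto
  have ne: "?S \<noteq> {}" using assms by auto
  have bdd: "bdd_above ?S" by (auto intro: bdd_aboveI[of _ t])
  have "closed ?S"
    by (intro continuous_on_closed_Collect_le cont continuous_intros closed_atLeastAtMost)
  then have r: "r \<in> ?S"
    unfolding r_def using ne bdd by (intro closed_contains_Sup)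
  with nle have rt: "r < t" by (cases "r = t") auto
  have above: "c < x s" if "r < s" "s \<le> t" for s
    using cSup_upper[OF _ bdd, of s] that r by (force simp: r_def)
  have "continuous (at r within {t0..t}) x"
    using cont r by (simp add: continuous_on_eq_continuous_within)
  \<comment> \<open>The tolerance is the gap between \<open>c\<close> and
    \<open>- sqrt p_plus\<close>, which keeps the path under \<open>- sqrt p_plus\<close> for a
    short while after \<open>r\<close>.\<close>
  then obtain d where d: "d > 0" "\<And>s. s \<in> {t0..t} \<Longrightarrow> dist s r < d \<Longrightarrow> dist (x s) (x r) < - sqrt p_plus - c"
    unfolding continuous_within_eps_delta using c by (metis diff_gt_0_iff_gt)
  define v where "v = min t (r + d / 2)"
  have v: "r < v" "v \<le> t" "v - r < d" using d rt by (auto simp: v_def min_def)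
  have "x s \<le> - sqrt p_plus" if "r \<le> s" "s \<le> v" for s
    using d(2)[of s] that v r by (auto simp: dist_real_def)
  then have "x v - x r \<le> (v - r) * (p_plus - (- sqrt p_plus)\<^sup>2)"
    using r v run assms(2) p_less by (intro increment_le) auto
  then have "x v \<le> x r" using p_less by simp
  with above[of v] v r show False by auto
qed

lemma square_gt: "p_plus < c\<^sup>2" if "c < - sqrt p_plus" for c
proof -
  have "(sqrt p_plus)\<^sup>2 < (- c)\<^sup>2"
    using that p_less by (intro power_strict_mono) auto
  then show ?thesis using p_less by simp
qed

lemma hits_target:
  assumes c: "c < - sqrt p_plus" and "0 \<le> t0" "x t0 \<le> c"
  shows "\<exists>t\<ge>0. x t \<le> a"
proof (rule ccontr)
  assume "\<not> ?thesis"
  then have run: "\<And>s. 0 \<le> s \<Longrightarrow> a < x s" by (meson not_le)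
  define k where "k = c\<^sup>2 - p_plus"
  have k: "0 < k" using square_gt[OF c] by (simp add: k_def)
  have below: "x t \<le> c" if "t0 \<le> t" for t
    using barrier[OF c assms(2,3) that] run by auto
  \<comment> \<open>The time at which a descent from \<open>c\<close> at constant speed
    \<open>k\<close> arrives at \<open>a\<close>.\<close>
  define v where "v = t0 + (c - a) / k"
  have "a < c" using run[OF assms(2)] assms(3) by simp
  then have v: "t0 \<le> v" using k by (simp add: v_def)
  have "c \<le> 0" using c p_less real_sqrt_gt_zero[of p_plus] by linarith
  then have "x v - x t0 \<le> (v - t0) * (p_plus - c\<^sup>2)"
    using below run v assms(2) by (intro increment_le) auto
  also have "\<dots> = - (c - a)" using k by (simp add: v_def k_def field_simps)
  finally show False using run[of v] v assms by simp
qed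

text \<open>From its first visit \<open>r\<close> to level \<open>a + 1\<close> the path stays below
  that level and falls at speed at least \<open>k\<close>, so the remaining unit of height takes at
  most \<open>1 / k\<close>. Both hitting times are finite, hence the difference is one of real
  numbers.\<close>

lemma descent_time:
  assumes c: "a + 1 < - sqrt p_plus" and hit: "0 \<le> t0" "x t0 \<le> a + 1"
  shows "hitting_time a x - hitting_time (a + 1) x \<le> ereal (1 / ((a + 1)\<^sup>2 - p_plus))"
proof -
  define k where "k = (a + 1)\<^sup>2 - p_plus"
  have k: "0 < k" using square_gt[OF c] by (simp add: k_def)
  obtain r where r: "0 \<le> r" "hitting_time (a + 1) x = ereal r" "x r \<le> a + 1"
    using hitting_time_attained[OF continuous] hit by metis
  obtain s where s: "0 \<le> s" "hitting_time a x = ereal s" "x s \<le> a" "\<And>t. 0 \<le> t \<Longrightarrow> t < s \<Longrightarrow> a < x t"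
    using hitting_time_attained[OF continuous hits_target[OF c hit]] by metis
  have "s - r \<le> 1 / k"
  proof (rule ccontr)
    assume *: "\<not> ?thesis"
    define v where "v = r + 1 / k"
    have v: "r \<le> v" "v < s" using * k by (auto simp: v_def)
    have below: "x t \<le> a + 1" if "r \<le> t" "t \<le> v" for t
      using barrier[OF c r(1,3) that(1)] s(4) v that by simp
    have "a + 1 \<le> 0" using c p_less real_sqrt_gt_zero[of p_plus] by linarith
    then have "x v - x r \<le> (v - r) * (p_plus - (a + 1)\<^sup>2)"
      using below v r s(4) by (intro increment_le) auto
    also have "\<dots> = - 1" using k by (simp add: v_def k_def field_simps)
    finally show False using s(4)[of v] v r by simp
  qed
  then show ?thesis using r s by (simp add: k_def)
qed

text \<open>In state \<open>-1\<close> the quantity \<open>arctan x\<close> decreases at least at speed \<open>min 1 (- p_minus)\<close>,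
  so the solution blows up within the time \<open>pi / min 1 (- p_minus)\<close>, whatever its initial value.\<close>

lemma hits_during_negative_phase:
  assumes T: "T = pi / min 1 (- p_minus)" and "0 \<le> t0"
    and e: "\<And>t. t0 \<le> t \<Longrightarrow> t \<le> t0 + T \<Longrightarrow> e t = - 1"
  shows "\<exists>t\<ge>0. x t \<le> a"
proof (rule ccontr)
  assume "\<not> ?thesis"
  then have run: "\<And>s. 0 \<le> s \<Longrightarrow> a < x s" by (meson not_le)
  define m where "m = min 1 (- p_minus)"
  have m: "0 < m" "m \<le> 1" "m \<le> - p_minus" using p_less by (auto simp: m_def)
  have "0 < T" using m by (simp add: T m_def[symmetric])
  let ?I = "{t0..t0 + T}"
  let ?h = "\<lambda>t. p_minus - (x t)\<^sup>2"
  \<comment> \<open>With the state frozen at \<open>-1\<close> the integrand is continuous, so the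
    integral equation upgrades to a differential equation and the chain rule applies to
    \<open>arctan\<close>.\<close>
  have cont: "continuous_on ?I ?h"
    using assms(2) by (intro continuous_intros continuous_on_subset[OF continuous]) auto
  have x_eq: "x t = x t0 + Henstock_Kurzweil_Integration.integral {t0..t} ?h" if "t \<in> ?I" for t
  proof -
    have "(f has_integral (x t - x t0)) {t0..t}"
      using that assms(2) run by (intro increment) auto
    then have "(?h has_integral (x t - x t0)) {t0..t}"
      by (rule has_integral_eq[rotated]) (use e that in \<open>auto simp: vec_field_def\<close>)
    then show ?thesis by (simp add: integral_unique)
  qed
  have deriv: "(x has_real_derivative ?h t) (at t within ?I)" if "t \<in> ?I" for t
  proof -
    have "((\<lambda>t. x t0 + Henstock_Kurzweil_Integration.integral {t0..t} ?h) has_real_derivative ?h t) (at t within ?I)"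
      using integral_has_vector_derivative[OF cont that]
      by (auto intro!: derivative_eq_intros simp: has_real_derivative_iff_has_vector_derivative)
    then show ?thesis
      by (rule has_field_derivative_transform_within[where d = 1]) (use that x_eq[symmetric] in auto)
  qed
  have "((\<lambda>t. (1 / (1 + (x t)\<^sup>2)) * ?h t) has_integral (arctan (x (t0 + T)) - arctan (x t0))) ?I"
  proof (rule fundamental_theorem_of_calculus)
    fix t assume "t \<in> ?I"
    then show "((\<lambda>t. arctan (x t)) has_vector_derivative (1 / (1 + (x t)\<^sup>2)) * ?h t) (at t within ?I)"
      unfolding has_real_derivative_iff_has_vector_derivative[symmetric]
      using deriv by (auto intro!: derivative_eq_intros simp: divide_simps)
  qed (use \<open>0 < T\<close> in simp)
  moreover have "((\<lambda>_. - m) has_integral T * - m) ?I"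
    using has_integral_const_real[of "- m" t0 "t0 + T"] \<open>0 < T\<close> by simp
  ultimately have "arctan (x (t0 + T)) - arctan (x t0) \<le> T * - m"
  proof (rule has_integral_le)
    fix t
    \<comment> \<open>This explains the minimum in \<open>m\<close>: the constant term uses
      \<open>m \<le> - p_minus\<close>, the quadratic one \<open>m \<le> 1\<close>.\<close>
    have "m + m * (x t)\<^sup>2 \<le> - p_minus + 1 * (x t)\<^sup>2"
      using m by (intro add_mono mult_right_mono) auto
    moreover have "0 < 1 + (x t)\<^sup>2" by (simp add: add_pos_nonneg)
    ultimately show "(1 / (1 + (x t)\<^sup>2)) * ?h t \<le> - m"
      by (simp add: field_simps)
  qed
  \<comment> \<open>The forced drop is at least \<open>pi\<close>, whereas two values of
    \<open>arctan\<close> always differ by strictly less.\<close>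
  moreover have "T * - m = - pi" using m by (simp add: T m_def[symmetric])
  ultimately show False
    using arctan_lbound[of "x (t0 + T)"] arctan_ubound[of "x t0"] by linarith
qed

end

text \<open>The probability space need not be complete, so measurability has to be derived from
  the continuity of the paths.\<close>

lemma measurable_hitting_event:
  fixes X :: "real \<Rightarrow> 'w \<Rightarrow> real"
  assumes meas: "\<And>t. 0 \<le> t \<Longrightarrow> X t \<in> borel_measurable M"
    and cont: "\<And>\<omega>. \<omega> \<in> space M \<Longrightarrow> continuous_on {0..} (\<lambda>t. X t \<omega>)"
  shows "{\<omega> \<in> space M. \<exists>t\<ge>0. X t \<omega> \<le> b} \<in> sets M"
proof -
  \<comment> \<open>Rational times make the event countable. The bound \<open>N\<close> gives a
    compact time window on which the minimum is attained, and the tolerance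
    \<open>1 / (k + 1)\<close> is there because the level may be reached at irrational times
    only.\<close>
  define Q where "Q N = {q \<in> \<rat>. 0 \<le> q \<and> q \<le> real N}" for N
  have cQ: "countable (Q N)" for N
    unfolding Q_def by (rule countable_subset[OF _ countable_rat]) auto
  have "(\<exists>t\<ge>0. X t \<omega> \<le> b) \<longleftrightarrow> (\<exists>N. \<forall>k. \<exists>q\<in>Q N. X q \<omega> \<le> b + 1 / real (Suc k))"
    if "\<omega> \<in> space M" for \<omega>
  proof
    assume "\<exists>t\<ge>0. X t \<omega> \<le> b"
    then obtain t where t: "0 \<le> t" "X t \<omega> \<le> b" by auto
    obtain N where N: "t < real N" using reals_Archimedean2 by blast
    have "\<exists>q\<in>Q N. X q \<omega> \<le> b + 1 / real (Suc k)" for k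
    proof -
      have "continuous (at t within {0..}) (\<lambda>t. X t \<omega>)"
        using cont[OF that] t by (simp add: continuous_on_eq_continuous_within)
      then obtain d where d: "d > 0"
        "\<And>s. s \<in> {0..} \<Longrightarrow> dist s t < d \<Longrightarrow> dist (X s \<omega>) (X t \<omega>) < 1 / real (Suc k)"
        unfolding continuous_within_eps_delta by (metis of_nat_0_less_iff zero_less_Suc zero_less_divide_1_iff)
      \<comment> \<open>Choosing \<open>q\<close> to the right of \<open>t\<close> keeps it
        nonnegative even for \<open>t = 0\<close>.\<close>
      obtain q where q: "q \<in> \<rat>" "t < q" "q < min (real N) (t + d)"
        using Rats_dense_in_real[of t "min (real N) (t + d)"] N d by auto
      then have "dist (X q \<omega>) (X t \<omega>) < 1 / real (Suc k)"
        using t by (intro d(2)) (auto simp: dist_real_def)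
      then show ?thesis
        using q t by (intro bexI[of _ q]) (auto simp: Q_def dist_real_def)
    qed
    then show "\<exists>N. \<forall>k. \<exists>q\<in>Q N. X q \<omega> \<le> b + 1 / real (Suc k)" by auto
  next
    assume "\<exists>N. \<forall>k. \<exists>q\<in>Q N. X q \<omega> \<le> b + 1 / real (Suc k)"
    then obtain N where N: "\<And>k. \<exists>q\<in>Q N. X q \<omega> \<le> b + 1 / real (Suc k)" by auto
    have "continuous_on {0..real N} (\<lambda>t. X t \<omega>)"
      using cont[OF that] by (rule continuous_on_subset) auto
    then obtain t where t: "t \<in> {0..real N}" "\<And>s. s \<in> {0..real N} \<Longrightarrow> X t \<omega> \<le> X s \<omega>"
      using continuous_attains_inf[of "{0..real N}" "\<lambda>t. X t \<omega>"] by auto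
    have "X t \<omega> \<le> b"
    proof (rule ccontr)
      assume "\<not> X t \<omega> \<le> b"
      then obtain k where k: "1 / real (Suc k) < X t \<omega> - b"
        using nat_approx_posE[of "X t \<omega> - b"] by auto
      obtain q where "q \<in> Q N" "X q \<omega> \<le> b + 1 / real (Suc k)" using N by blast
      then show False using t(2)[of q] k by (auto simp: Q_def)
    qed
    then show "\<exists>t\<ge>0. X t \<omega> \<le> b" using t by auto
  qed
  then have "{\<omega> \<in> space M. \<exists>t\<ge>0. X t \<omega> \<le> b} =
      {\<omega> \<in> space M. \<exists>N. \<forall>k. \<exists>q\<in>Q N. X q \<omega> \<le> b + 1 / real (Suc k)}"
    by auto
  also have "\<dots> \<in> sets M"
  proof (intro sets.sets_Collect_countable_Ex sets.sets_Collect_countable_All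
      sets.sets_Collect_countable_Ex' cQ)
    fix N k q assume "q \<in> Q N"
    then have [measurable]: "X q \<in> borel_measurable M" by (intro meas) (auto simp: Q_def)
    show "{\<omega> \<in> space M. X q \<omega> \<le> b + 1 / real (Suc k)} \<in> sets M" by measurable
  qed
  finally show ?thesis .
qed

section \<open>Almost surely the chain has a long stay in state -1\<close>

text \<open>By independence the first \<open>N\<close> selected coordinates all stay at or below
  \<open>c\<close> with probability \<open>r ^ N\<close>, and \<open>r < 1\<close> because the
  exponential law has unbounded support. The selection \<open>j\<close> allows even and odd indices
  to be treated separately.\<close>

lemma AE_exponential_exceeds:
  fixes c :: real and j :: "nat \<Rightarrow> nat"
  assumes "inj j"
  shows "AE y in PiM UNIV (\<lambda>_ :: nat. density lborel (exponential_density 1)). \<exists>n. c < y (j n)"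
proof -
  let ?D = "density lborel (exponential_density 1)"
  let ?P = "PiM UNIV (\<lambda>_ :: nat. ?D)"
  interpret D: prob_space ?D by (rule prob_space_exponential_density) simp
  interpret P: product_prob_space "\<lambda>_ :: nat. ?D" UNIV ..
  define r where "r = measure ?D {..c}"
  have "r = erlang_CDF 0 1 c"
    unfolding r_def measure_def by (simp add: emeasure_erlang_density)
  then have r: "0 \<le> r" "r < 1" by (auto simp: erlang_CDF_0)
  have eq: "{y \<in> space ?P. \<forall>n<N. y (j n) \<le> c} =
      prod_emb UNIV (\<lambda>_. ?D) (j ` {..<N}) (PiE (j ` {..<N}) (\<lambda>_. {..c}))" for N
    by (auto simp: prod_emb_def space_PiM PiE_iff extensional_def restrict_def)
  have prob: "measure ?P {y \<in> space ?P. \<forall>n<N. y (j n) \<le> c} = r ^ N" for N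
    unfolding eq
    by (subst P.measure_PiM_emb) (auto simp: r_def card_image inj_on_subset[OF assms])
  let ?B = "{y \<in> space ?P. \<forall>n. y (j n) \<le> c}"
  have B: "?B \<in> sets ?P" by measurable
  have "measure ?P ?B \<le> r ^ N" for N
    unfolding prob[symmetric, of N]
  proof (rule P.finite_measure_mono)
    show "{y \<in> space ?P. \<forall>n<N. y (j n) \<le> c} \<in> sets ?P" by measurable
  qed auto
  moreover have "(\<lambda>N. r ^ N) \<longlonglongrightarrow> 0" using r by (intro LIMSEQ_realpow_zero)
  ultimately have "measure ?P ?B \<le> 0" by (intro LIMSEQ_le_const) auto
  then have "emeasure ?P ?B = 0"
    by (simp add: P.emeasure_eq_measure measure_le_0_iff)
  then have "AE y in ?P. y \<notin> ?B" using B by (intro AE_not_in) (auto simp: null_sets_def)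
  with AE_space show ?thesis by eventually_elim (auto simp: not_le)
qed

text \<open>State \<open>-1\<close> occupies every second phase, and its scaled holding times are
  standard exponential, so one of them exceeds \<open>lam_minus * T\<close>.\<close>

lemma switching_chain_long_negative_phase:
  assumes sw: "switching_chain lam_minus lam_plus \<nu> M X0 E"
    and "prob_space \<nu>" and sets: "sets \<nu> = sets state_space" and "0 < lam_minus"
  shows "AE \<omega> in M. \<exists>t0\<ge>0. \<forall>t. t0 \<le> t \<longrightarrow> t \<le> t0 + T \<longrightarrow> E t \<omega> = - 1"
proof -
  let ?D = "density lborel (exponential_density 1)"
  let ?P = "PiM UNIV (\<lambda>_ :: nat. ?D)"
  let ?\<mu> = "\<nu> \<Otimes>\<^sub>M ?P"
  obtain H where H: "\<And>\<omega> n. \<omega> \<in> space M \<Longrightarrow> 0 < H n \<omega>"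
      "\<And>\<omega> n t. \<omega> \<in> space M \<Longrightarrow> (\<Sum>k<n. H k \<omega>) \<le> t \<Longrightarrow> t < (\<Sum>k<Suc n. H k \<omega>) \<Longrightarrow>
         E t \<omega> = (-1) ^ n * E 0 \<omega>"
    and meas: "(\<lambda>\<omega>. ((X0 \<omega>, E 0 \<omega>),
         \<lambda>n. exit_rate lam_minus lam_plus ((-1) ^ n * E 0 \<omega>) * H n \<omega>)) \<in> measurable M ?\<mu>"
    and distr: "distr M ?\<mu> (\<lambda>\<omega>. ((X0 \<omega>, E 0 \<omega>),
         \<lambda>n. exit_rate lam_minus lam_plus ((-1) ^ n * E 0 \<omega>) * H n \<omega>)) = ?\<mu>"
    using sw unfolding switching_chain_def Let_def by blast
  interpret \<nu>: prob_space \<nu> by fact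
  interpret D: prob_space ?D by (rule prob_space_exponential_density) simp
  interpret P: prob_space ?P by (intro prob_space_PiM D.prob_space_axioms)
  interpret pair_sigma_finite \<nu> ?P ..
  define c where "c = lam_minus * T"
  \<comment> \<open>Whether the even or the odd phases are negative depends on the random
    \<open>E 0\<close>; securing both parities at once avoids conditioning on it.\<close>
  have "AE y in ?P. (\<exists>n. c < y (2 * n)) \<and> (\<exists>n. c < y (Suc (2 * n)))"
    by (intro AE_conjI AE_exponential_exceeds) (auto simp: inj_on_def)
  then have "AE z in ?\<mu>. (\<exists>n. c < snd z (2 * n)) \<and> (\<exists>n. c < snd z (Suc (2 * n)))"
    by (intro AE_pair_measure) auto
  then have "AE \<omega> in M. (\<exists>n. c < exit_rate lam_minus lam_plus ((-1) ^ (2 * n) * E 0 \<omega>) * H (2 * n) \<omega>)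
      \<and> (\<exists>n. c < exit_rate lam_minus lam_plus ((-1) ^ Suc (2 * n) * E 0 \<omega>) * H (Suc (2 * n)) \<omega>)"
    using AE_distrD[OF meas] unfolding distr by force
  with AE_space show ?thesis
  proof eventually_elim
    case (elim \<omega>)
    \<comment> \<open>That the initial state is \<open>1\<close> or \<open>-1\<close> is encoded in
      the measurability of the map into the product with \<open>\<nu>\<close>.\<close>
    have "((X0 \<omega>, E 0 \<omega>), \<lambda>n. exit_rate lam_minus lam_plus ((-1) ^ n * E 0 \<omega>) * H n \<omega>) \<in> space ?\<mu>"
      using measurable_space[OF meas elim(1)] .
    then have E0: "E 0 \<omega> \<in> {-1, 1}"
      using sets_eq_imp_space_eq[OF sets] by (auto simp: space_pair_measure state_space_def)
    obtain n where n: "(-1) ^ n * E 0 \<omega> = -1" "c < exit_rate lam_minus lam_plus (-1) * H n \<omega>"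
    proof (cases "E 0 \<omega> = 1")
      case True
      obtain n where "c < exit_rate lam_minus lam_plus ((-1) ^ Suc (2 * n) * E 0 \<omega>) * H (Suc (2 * n)) \<omega>"
        using elim by blast
      then show ?thesis using True by (intro that[of "Suc (2 * n)"]) auto
    next
      case False
      obtain n where "c < exit_rate lam_minus lam_plus ((-1) ^ (2 * n) * E 0 \<omega>) * H (2 * n) \<omega>"
        using elim by blast
      then show ?thesis using False E0 by (intro that[of "2 * n"]) auto
    qed
    \<comment> \<open>Strictness places the closed interval of length \<open>T\<close> inside the
      half-open phase.\<close>
    have "T < H n \<omega>"
      using n(2) \<open>0 < lam_minus\<close> by (simp add: c_def exit_rate_def)
    then have "E t \<omega> = - 1" if "(\<Sum>k<n. H k \<omega>) \<le> t" "t \<le> (\<Sum>k<n. H k \<omega>) + T" for t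
      using H(2)[OF elim(1), of n t] that n(1) by simp
    moreover have "0 \<le> (\<Sum>k<n. H k \<omega>)" using H(1)[OF elim(1)] by (intro sum_nonneg less_imp_le)
    ultimately show ?case by blast
  qed
qed

section \<open>Integrability of the bound, and the conclusion\<close>

text \<open>The substitution \<open>y = - (a + d)\<close> turns the half-line into one that starts
  at the positive number \<open>- b - d\<close>, where \<open>1 / y^2\<close> is integrable up to
  infinity.\<close>

lemma set_integrable_inverse_square:
  fixes b d :: real
  assumes "b + d < 0"
  shows "set_integrable lborel {..b} (\<lambda>a. 2 / (a + d)\<^sup>2)"
proof -
  let ?f = "\<lambda>y :: real. indicator {- b - d..} y *\<^sub>R (1 / y\<^sup>2)"
  have "(\<lambda>y :: real. 1 / y\<^sup>2) absolutely_integrable_on {- b - d..}"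
    using has_integral_inverse_power_to_inf[of 2 "- b - d"] assms
    by (intro nonnegative_absolutely_integrable_1) auto
  \<comment> \<open>Absolute integrability refers to the completed Lebesgue measure; Borel
    measurability of the integrand brings it back to \<open>lborel\<close>.\<close>
  then have "set_integrable lborel {- b - d..} (\<lambda>y :: real. 1 / y\<^sup>2)"
    unfolding set_integrable_def by (subst (asm) integrable_completion) auto
  then have "integrable lborel (\<lambda>a. ?f (- d + (- 1) * a))"
    unfolding set_integrable_def by (rule lborel_integrable_real_affine) simp
  then have "integrable lborel (\<lambda>a. 2 * ?f (- d + (- 1) * a))"
    by (rule integrable_mult_right)
  also have "(\<lambda>a. 2 * ?f (- d + (- 1) * a)) = (\<lambda>a. indicator {..b} a *\<^sub>R (2 / (a + d)\<^sup>2))"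
    by (auto simp: fun_eq_iff indicator_def power2_commute[of "- d"] power2_eq_square algebra_simps)
  finally show ?thesis unfolding set_integrable_def .
qed

theorem theorem4p2:
  fixes p_minus p_plus lam_minus lam_plus :: real and \<nu> :: "(real \<times> int) measure"
  assumes "p_minus < 0" and "0 < p_plus" and "0 < lam_minus" and "0 < lam_plus"
    and "prob_space \<nu>" and "sets \<nu> = sets state_space"
  shows "\<exists>g :: real \<Rightarrow> real.
     mono_on {..- sqrt p_plus - 2} g \<and>
     (\<forall>a \<le> - sqrt p_plus - 2. 0 < g a) \<and>
     set_integrable lborel {..- sqrt p_plus - 2} g \<and>
     (\<forall>a \<le> - sqrt p_plus - 2. \<forall>(M :: 'w measure) X F.
        stopped_pdmp p_minus p_plus lam_minus lam_plus \<nu> a M X F \<longrightarrow>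
          \<P>(\<omega> in M. hitting_time (- sqrt p_plus - 1) (\<lambda>t. X t \<omega>) < \<infinity>) = 1 \<and>
          \<P>(\<omega> in M. hitting_time a (\<lambda>t. X t \<omega>) - hitting_time (a + 1) (\<lambda>t. X t \<omega>) < ereal (g a)
              \<bar> hitting_time (- sqrt p_plus - 1) (\<lambda>t. X t \<omega>) < \<infinity>) = 1)"
proof -
  \<comment> \<open>With \<open>q = - (a + 1) - sqrt p_plus\<close> one has
    \<open>(a + 1)^2 - p_plus = q^2 + 2 * q * sqrt p_plus\<close>, so the descent time is at most
    \<open>1 / q^2\<close>. The numerator \<open>2\<close> makes the inequality strict, and
    \<open>q \<ge> 1\<close> on the domain keeps \<open>g\<close> away from its pole.\<close>
  define g where "g a = 2 / (a + (1 + sqrt p_plus))\<^sup>2" for a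
  have sqrt_pos: "0 < sqrt p_plus" using assms(2) by simp
  have "mono_on {..- sqrt p_plus - 2} g"
    unfolding g_def
    by (intro mono_onI divide_left_mono) (auto simp: abs_le_square_iff[symmetric])
  moreover have "\<forall>a \<le> - sqrt p_plus - 2. 0 < g a"
    by (auto simp: g_def)
  moreover have "set_integrable lborel {..- sqrt p_plus - 2} g"
    unfolding g_def by (rule set_integrable_inverse_square) simp
  moreover have "\<P>(\<omega> in M. hitting_time (- sqrt p_plus - 1) (\<lambda>t. X t \<omega>) < \<infinity>) = 1 \<and>
      \<P>(\<omega> in M. hitting_time a (\<lambda>t. X t \<omega>) - hitting_time (a + 1) (\<lambda>t. X t \<omega>) < ereal (g a)
          \<bar> hitting_time (- sqrt p_plus - 1) (\<lambda>t. X t \<omega>) < \<infinity>) = 1"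
    if a: "a \<le> - sqrt p_plus - 2" and pdmp: "stopped_pdmp p_minus p_plus lam_minus lam_plus \<nu> a M X F"
    for a X F and M :: "'w measure"
  proof -
    define b where "b = - sqrt p_plus - 1"
    have ab: "a + 1 \<le> b" and b: "b < - sqrt p_plus" using a by (auto simp: b_def)
    interpret prob_space M using pdmp by (simp add: stopped_pdmp_def)
    obtain E where sw: "switching_chain lam_minus lam_plus \<nu> M (X 0) E"
      and int: "\<And>\<omega>. \<omega> \<in> space M \<Longrightarrow> stopped_path p_minus p_plus a (\<lambda>t. E t \<omega>) (\<lambda>t. X t \<omega>)"
      using pdmp assms(1,2) unfolding stopped_pdmp_def stopped_path_def Let_def by blast
    let ?B = "\<lambda>\<omega>. hitting_time b (\<lambda>t. X t \<omega>) < \<infinity>"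
    let ?A = "\<lambda>\<omega>. hitting_time a (\<lambda>t. X t \<omega>) - hitting_time (a + 1) (\<lambda>t. X t \<omega>) < ereal (g a)"
    \<comment> \<open>The long negative phase carries the path all the way to \<open>a\<close>,
      which lies below \<open>b\<close>.\<close>
    have "AE \<omega> in M. ?B \<omega>"
      using switching_chain_long_negative_phase[OF sw assms(5,6,3), of "pi / min 1 (- p_minus)"] AE_space
    proof eventually_elim
      case (elim \<omega>)
      then obtain t where "0 \<le> t" "X t \<omega> \<le> a"
        using stopped_path.hits_during_negative_phase[OF int[OF elim(2)] refl] by blast
      then show ?case
        unfolding hitting_time_finite_iff using ab by (intro exI[of _ t]) auto
    qed
    moreover have "{\<omega> \<in> space M. ?B \<omega>} \<in> sets M"
      unfolding hitting_time_finite_iff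
      using pdmp by (intro measurable_hitting_event stopped_path.continuous[OF int]) (auto simp: stopped_pdmp_def)
    ultimately have B: "\<P>(\<omega> in M. ?B \<omega>) = 1" by (simp add: prob_Collect_eq_1)
    \<comment> \<open>The time bound holds at every sample point of \<open>?B\<close>: once
      \<open>b\<close> is passed, the barrier forces the path on to \<open>a\<close>.\<close>
    have "?A \<omega>" if \<omega>: "\<omega> \<in> space M" and "?B \<omega>" for \<omega>
    proof -
      interpret stopped_path p_minus p_plus a "\<lambda>t. E t \<omega>" "\<lambda>t. X t \<omega>" by (rule int[OF \<omega>])
      obtain t0 where "0 \<le> t0" "X t0 \<omega> \<le> b"
        using \<open>?B \<omega>\<close> unfolding hitting_time_finite_iff by auto
      then obtain t where t: "0 \<le> t" "X t \<omega> \<le> a" using hits_target[OF b] by blast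
      define q where "q = - (a + 1) - sqrt p_plus"
      have q: "1 \<le> q" using a by (simp add: q_def)
      have "(a + 1)\<^sup>2 - p_plus = q\<^sup>2 + 2 * q * sqrt p_plus"
        using assms(2) by (simp add: q_def power2_eq_square algebra_simps)
      moreover have "0 < q * sqrt p_plus" using q sqrt_pos by simp
      ultimately have "1 / ((a + 1)\<^sup>2 - p_plus) \<le> 1 / q\<^sup>2"
        using q assms(2) by (intro divide_left_mono) (auto intro!: mult_pos_pos add_pos_pos)
      also have "\<dots> < 2 / q\<^sup>2" using q by (intro divide_strict_right_mono) auto
      also have "q\<^sup>2 = (a + (1 + sqrt p_plus))\<^sup>2"
        by (simp add: q_def power2_eq_square algebra_simps)
      finally have "ereal (1 / ((a + 1)\<^sup>2 - p_plus)) < ereal (g a)" by (simp add: g_def)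
      with descent_time[of t] t a show ?thesis by (auto intro: le_less_trans)
    qed
    \<comment> \<open>The conditional probability is therefore the quotient of the probability of
      \<open>?B\<close> by itself, and that probability is \<open>1\<close>, so the division is
      genuine.\<close>
    then have "{\<omega> \<in> space M. ?A \<omega> \<and> ?B \<omega>} = {\<omega> \<in> space M. ?B \<omega>}" by auto
    with B have "\<P>(\<omega> in M. ?A \<omega> \<bar> ?B \<omega>) = 1" by (simp add: cond_prob_def)
    with B show ?thesis by (simp add: b_def)
  qed
  ultimately show ?thesis by blast
qed

end
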